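(* Let $n\ge 1$, let $t\ge 2$ be an even integer, and let $g\in\mathbb{R}[x_1,\ldots,x_n]$ be a nonnegative homogeneous polynomial of degree $t$. Let $\mathbf{B}=[-1,1]^n$ and $\mathbf{K}=\{\mathbf{x}\in\mathbb{R}^n : g(\mathbf{x})\le 1\}$, and assume that $\mathbf{K}\subset\mathbf{B}$ and $\partial\mathbf{K}\subset\{\mathbf{x}: g(\mathbf{x})=1\}$. Let $\lambda$ be the Lebesgue measure on $\mathbf{B}$ normalized to a probability measure, and let $\#\lambda$ be the pushforward of $\lambda$ by $g:\mathbf{B}\to\mathbb{R}$. For every integer $d\ge 1$ define $$\rho_d=\max_{\boldsymbol{\phi}=(\phi_j)_{j\le 2d}}\bigl\{\phi_0:\ 0\preceq\mathbf{M}_d(\boldsymbol{\phi})\preceq\mathbf{M}_d(\#\lambda),\ \ \mathbf{M}_{d-1}(x(1-x)\,\boldsymbol{\phi})\succeq 0\bigr\},$$ where the maximum is over real sequences $(\phi_0,\ldots,\phi_{2d})$, and $$\tau_d=\lambda_{\min}(\mathbf{M}_d(\#\lambda),\mathbf{M}^*_d)=\max\{\tau\in\mathbb{R}:\ \tau\,\mathbf{M}^*_d\preceq\mathbf{M}_d(\#\lambda)\},$$ where $\mathbf{M}^*_d$ is the $(d+1)\times(d+1)$ Hankel matrix with entries $\mathbf{M}^*_d(k,\ell)=\frac{n}{n+(k+\ell-2)t}$, $k,\ell=1,\ldots,d+1$. Then $\rho_d\ge\tau_d$ for every $d\geq 1$.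
   Context: The pushforward of $\lambda$ by $g$ is the Borel measure $\#\lambda(C)=\lambda(\{\mathbf{x}\in\mathbf{B}: g(\mathbf{x})\in C\})$ on $\mathbb{R}$, with moments $\#\lambda_k=\int z^k\,\#\lambda(dz)=\int_{\mathbf{B}} g(\mathbf{x})^k\,\lambda(d\mathbf{x})$. For a real sequence $\boldsymbol{\phi}=(\phi_j)_{j\le 2d}$, the moment matrix $\mathbf{M}_d(\boldsymbol{\phi})$ is the $(d+1)\times(d+1)$ Hankel matrix with entries $\phi_{k+\ell-2}$, $k,\ell=1,\ldots,d+1$; $\mathbf{M}_d(\#\lambda)$ is this matrix for the moment sequence $(\#\lambda_k)$. The localizing matrix $\mathbf{M}_{d-1}(x(1-x)\,\boldsymbol{\phi})$ is the $d\times d$ Hankel matrix with entries $\phi_{k+\ell-1}-\phi_{k+\ell}$, $k,\ell=1,\ldots,d$. $\mathbf{A}\preceq\mathbf{C}$ means that $\mathbf{C}-\mathbf{A}$ is positive semidefinite. $\lambda_{\min}(\mathbf{A},\mathbf{C})$ denotes the smallest generalized eigenvalue of the pair, i.e. the smallest scalar $\theta$ such that $\mathbf{A}\mathbf{v}=\theta\,\mathbf{C}\mathbf{v}$ for some nonzero vector $\mathbf{v}$. *)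

theory Defs
  imports
    "HOL-Analysis.Analysis"
    "HOL-Library.Poly_Mapping"
    "Jordan_Normal_Form.Matrix"
begin

(* Polynomials in R[x_i : i in 'n] are finitely supported maps from exponent
   vectors to coefficients. *)

definition poly_eval :: "(('n::finite \<Rightarrow>\<^sub>0 nat) \<Rightarrow>\<^sub>0 real) \<Rightarrow> real ^ 'n \<Rightarrow> real" where
  "poly_eval p x =
     (\<Sum>m\<in>Poly_Mapping.keys p. Poly_Mapping.lookup p m * (\<Prod>i\<in>UNIV. vec_nth x i ^ Poly_Mapping.lookup m i))"

definition homogeneous_of_degree :: "(('n::finite \<Rightarrow>\<^sub>0 nat) \<Rightarrow>\<^sub>0 real) \<Rightarrow> nat \<Rightarrow> bool" where
  "homogeneous_of_degree p t \<longleftrightarrow> (\<forall>m\<in>Poly_Mapping.keys p. (\<Sum>i\<in>UNIV. Poly_Mapping.lookup m i) = t)"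

definition box_B :: "(real ^ 'n::finite) set" where
  "box_B = {x. \<forall>i. - 1 \<le> vec_nth x i \<and> vec_nth x i \<le> 1}"

definition lambda_B :: "(real ^ 'n::finite) measure" where
  "lambda_B = uniform_measure lborel box_B"

definition pushforward :: "(real ^ 'n::finite \<Rightarrow> real) \<Rightarrow> real measure" where
  "pushforward g = distr lambda_B borel g"

definition push_moment :: "(real ^ 'n::finite \<Rightarrow> real) \<Rightarrow> nat \<Rightarrow> real" where
  "push_moment g k = (LINT z|pushforward g. z ^ k)"

(* Matrix indices start at 0, so k and l of the usual 1-based description are
   i + 1 and j + 1.  Only the entries phi 0, ..., phi (2 * d) of a sequence
   occur in the two matrices below. *)

definition moment_matrix :: "nat \<Rightarrow> (nat \<Rightarrow> real) \<Rightarrow> real mat" where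
  "moment_matrix d \<phi> = mat (d + 1) (d + 1) (\<lambda>(i, j). \<phi> (i + j))"

definition localizing_matrix :: "nat \<Rightarrow> (nat \<Rightarrow> real) \<Rightarrow> real mat" where
  "localizing_matrix d \<phi> = mat d d (\<lambda>(i, j). \<phi> (i + j + 1) - \<phi> (i + j + 2))"

definition M_star :: "nat \<Rightarrow> nat \<Rightarrow> nat \<Rightarrow> real mat" where
  "M_star n t d = mat (d + 1) (d + 1) (\<lambda>(i, j). real n / (real n + real (i + j) * real t))"

definition psd :: "real mat \<Rightarrow> bool" where
  "psd A \<longleftrightarrow> square_mat A \<and> transpose_mat A = A \<and>
     (\<forall>v \<in> carrier_vec (dim_row A). 0 \<le> scalar_prod v (A *\<^sub>v v))"

definition loewner_le :: "real mat \<Rightarrow> real mat \<Rightarrow> bool" where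
  "loewner_le A C \<longleftrightarrow> psd (C - A)"

definition gen_eigenvalues :: "real mat \<Rightarrow> real mat \<Rightarrow> real set" where
  "gen_eigenvalues A C =
     {\<theta>. \<exists>v \<in> carrier_vec (dim_col A). v \<noteq> 0\<^sub>v (dim_col A) \<and> A *\<^sub>v v = \<theta> \<cdot>\<^sub>v (C *\<^sub>v v)}"

definition is_greatest :: "real set \<Rightarrow> real \<Rightarrow> bool" where
  "is_greatest S m \<longleftrightarrow> m \<in> S \<and> (\<forall>x\<in>S. x \<le> m)"

definition is_least :: "real set \<Rightarrow> real \<Rightarrow> bool" where
  "is_least S m \<longleftrightarrow> m \<in> S \<and> (\<forall>x\<in>S. m \<le> x)"

definition lambda_min :: "real mat \<Rightarrow> real mat \<Rightarrow> real" where
  "lambda_min A C = (THE \<theta>. is_least (gen_eigenvalues A C) \<theta>)"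

definition rho_values :: "(real ^ 'n::finite \<Rightarrow> real) \<Rightarrow> nat \<Rightarrow> real set" where
  "rho_values g d =
     {\<phi> 0 | \<phi>. loewner_le (0\<^sub>m (d + 1) (d + 1)) (moment_matrix d \<phi>) \<and>
               loewner_le (moment_matrix d \<phi>) (moment_matrix d (push_moment g)) \<and>
               loewner_le (0\<^sub>m d d) (localizing_matrix d \<phi>)}"

definition rho :: "(real ^ 'n::finite \<Rightarrow> real) \<Rightarrow> nat \<Rightarrow> real" where
  "rho g d = (THE r. is_greatest (rho_values g d) r)"

definition tau :: "(real ^ 'n::finite \<Rightarrow> real) \<Rightarrow> nat \<Rightarrow> nat \<Rightarrow> real" where
  "tau g t d = lambda_min (moment_matrix d (push_moment g)) (M_star CARD('n) t d)"

end

theory Submission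
  imports Defs
begin

text \<open>
  The numbers \<open>n / (n + k t)\<close> are the moments of \<open>s \<mapsto> s ^ t\<close> under the density
  \<open>n s\<^sup>n\<^sup>-\<^sup>1\<close> on \<open>[0, 1]\<close>. Hence the matrix \<open>M_star\<close> is positive definite, and its localizing
  matrix for \<open>x (1 - x)\<close> is positive semidefinite. Positive definiteness makes the generalized
  Rayleigh quotient attain its minimum, which is both the least generalized eigenvalue and the
  greatest \<open>\<tau>\<close> with \<open>\<tau> M_star\<close> below the moment matrix of the pushforward. As the latter is
  positive semidefinite, this \<open>\<tau>\<close> is nonnegative, so \<open>\<tau>\<close> times the moment sequence of \<open>M_star\<close> is
  feasible for \<open>\<rho>\<close>, with objective value \<open>\<tau>\<close>. The maximum defining \<open>\<rho>\<close> exists by compactness: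
  nonnegative diagonal and two-by-two principal minors bound every \<open>\<phi> k\<close> by the even moments of
  the pushforward.
\<close>

section \<open>Matrix notions translated into quadratic forms of kernels\<close>

text \<open>Kernels and vectors are total functions on the naturals, of which only the values below
  \<open>n\<close> count. This avoids dimension side conditions and places vectors in a product
  space, where compactness arguments apply.\<close>

definition quad_form :: "nat \<Rightarrow> (nat \<Rightarrow> nat \<Rightarrow> real) \<Rightarrow> (nat \<Rightarrow> real) \<Rightarrow> real" where
  "quad_form n a u = (\<Sum>i<n. \<Sum>j<n. u i * a i j * u j)"

abbreviation kernel_mat :: "nat \<Rightarrow> (nat \<Rightarrow> nat \<Rightarrow> real) \<Rightarrow> real mat" where
  "kernel_mat n a \<equiv> Matrix.mat n n (\<lambda>(i, j). a i j)"

lemma kernel_mat_mult_vec: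
  assumes "i < n"
  shows "vec_index (kernel_mat n a *\<^sub>v Matrix.vec n u) i = (\<Sum>j<n. a i j * u j)"
  using assms by (simp add: scalar_prod_def lessThan_atLeast0)

lemma scalar_prod_kernel_mat:
  "scalar_prod (Matrix.vec n u) (kernel_mat n a *\<^sub>v Matrix.vec n u) = quad_form n a u"
  by (simp add: scalar_prod_def quad_form_def sum_distrib_left mult.assoc lessThan_atLeast0)

lemma psd_kernel_mat_iff:
  assumes "\<And>i j. a i j = a j i"
  shows "psd (kernel_mat n a) \<longleftrightarrow> (\<forall>u. 0 \<le> quad_form n a u)"
proof -
  have "transpose_mat (kernel_mat n a) = kernel_mat n a"
    using assms by (intro eq_matI) auto
  moreover have "(\<forall>v\<in>carrier_vec n. 0 \<le> scalar_prod v (kernel_mat n a *\<^sub>v v)) \<longleftrightarrow>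
      (\<forall>u. 0 \<le> quad_form n a u)"
  proof
    assume "\<forall>v\<in>carrier_vec n. 0 \<le> scalar_prod v (kernel_mat n a *\<^sub>v v)"
    then show "\<forall>u. 0 \<le> quad_form n a u"
      by (metis scalar_prod_kernel_mat vec_carrier)
  next
    assume *: "\<forall>u. 0 \<le> quad_form n a u"
    show "\<forall>v\<in>carrier_vec n. 0 \<le> scalar_prod v (kernel_mat n a *\<^sub>v v)"
    proof
      fix v :: "real Matrix.vec" assume "v \<in> carrier_vec n"
      then have "v = Matrix.vec n (vec_index v)"
        by (intro eq_vecI) auto
      then show "0 \<le> scalar_prod v (kernel_mat n a *\<^sub>v v)"
        using * by (metis scalar_prod_kernel_mat)
    qed
  qed
  ultimately show ?thesis
    by (simp add: psd_def)
qed

lemma quad_form_diff: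
  "quad_form n (\<lambda>i j. c i j - a i j) u = quad_form n c u - quad_form n a u"
  by (simp add: quad_form_def algebra_simps sum_subtractf)

lemma quad_form_scale:
  "quad_form n (\<lambda>i j. \<tau> * a i j) u = \<tau> * quad_form n a u"
  by (simp add: quad_form_def sum_distrib_left mult_ac)

lemma quad_form_zero [simp]: "quad_form n (\<lambda>i j. 0) u = 0"
  by (simp add: quad_form_def)

lemma loewner_le_kernel_mat_iff:
  assumes "\<And>i j. a i j = a j i" "\<And>i j. c i j = c j i"
  shows "loewner_le (kernel_mat n a) (kernel_mat n c) \<longleftrightarrow>
    (\<forall>u. quad_form n a u \<le> quad_form n c u)"
proof -
  have "kernel_mat n c - kernel_mat n a = kernel_mat n (\<lambda>i j. c i j - a i j)"
    by (intro eq_matI) auto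
  moreover have "psd (kernel_mat n (\<lambda>i j. c i j - a i j)) \<longleftrightarrow>
      (\<forall>u. 0 \<le> quad_form n (\<lambda>i j. c i j - a i j) u)"
    using assms by (intro psd_kernel_mat_iff) metis
  ultimately show ?thesis
    by (simp add: loewner_le_def quad_form_diff)
qed

lemma zero_mat_eq_kernel_mat: "0\<^sub>m n n = kernel_mat n (\<lambda>i j. 0)"
  by (intro eq_matI) auto

lemma smult_kernel_mat: "\<tau> \<cdot>\<^sub>m kernel_mat n a = kernel_mat n (\<lambda>i j. \<tau> * a i j)"
  by (intro eq_matI) auto

lemma gen_eigenvalues_kernel_mat_iff:
  "\<theta> \<in> gen_eigenvalues (kernel_mat n a) (kernel_mat n c) \<longleftrightarrow>
    (\<exists>u. (\<exists>i<n. u i \<noteq> 0) \<and> (\<forall>i<n. (\<Sum>j<n. a i j * u j) = \<theta> * (\<Sum>j<n. c i j * u j)))"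
    (is "?L \<longleftrightarrow> ?R")
proof
  assume ?L
  then obtain v where v: "v \<in> carrier_vec n" "v \<noteq> 0\<^sub>v n"
    and eq: "kernel_mat n a *\<^sub>v v = \<theta> \<cdot>\<^sub>v (kernel_mat n c *\<^sub>v v)"
    by (auto simp: gen_eigenvalues_def)
  let ?u = "vec_index v"
  have vu: "v = Matrix.vec n ?u"
    using v(1) by (intro eq_vecI) auto
  have "\<exists>i<n. ?u i \<noteq> 0"
    using v by (metis carrier_vecD eq_vecI index_zero_vec)
  moreover have "(\<Sum>j<n. a i j * ?u j) = \<theta> * (\<Sum>j<n. c i j * ?u j)" if "i < n" for i
  proof -
    have "vec_index (kernel_mat n a *\<^sub>v Matrix.vec n ?u) i =
        vec_index (\<theta> \<cdot>\<^sub>v (kernel_mat n c *\<^sub>v Matrix.vec n ?u)) i"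
      using eq vu by simp
    then show ?thesis
      using that kernel_mat_mult_vec[OF that, of a ?u] kernel_mat_mult_vec[OF that, of c ?u] by simp
  qed
  ultimately show ?R by blast
next
  assume ?R
  then obtain u where u: "\<exists>i<n. u i \<noteq> 0"
    and eq: "\<And>i. i < n \<Longrightarrow> (\<Sum>j<n. a i j * u j) = \<theta> * (\<Sum>j<n. c i j * u j)"
    by blast
  have "Matrix.vec n u \<noteq> 0\<^sub>v n"
    using u by (metis index_vec index_zero_vec(1))
  moreover have "kernel_mat n a *\<^sub>v Matrix.vec n u = \<theta> \<cdot>\<^sub>v (kernel_mat n c *\<^sub>v Matrix.vec n u)"
  proof (rule eq_vecI)
    fix i assume "i < dim_vec (\<theta> \<cdot>\<^sub>v (kernel_mat n c *\<^sub>v Matrix.vec n u))"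
    then have "i < n" by simp
    then show "vec_index (kernel_mat n a *\<^sub>v Matrix.vec n u) i =
        vec_index (\<theta> \<cdot>\<^sub>v (kernel_mat n c *\<^sub>v Matrix.vec n u)) i"
      using eq kernel_mat_mult_vec[OF \<open>i < n\<close>, of a u] kernel_mat_mult_vec[OF \<open>i < n\<close>, of c u] by simp
  qed simp
  ultimately show ?L
    unfolding gen_eigenvalues_def by (auto intro!: bexI[of _ "Matrix.vec n u"])
qed

section \<open>Generalized Rayleigh quotient and the least generalized eigenvalue\<close>

text \<open>Symmetry merges the two cross terms, so the first-order coefficient in \<open>s\<close>
  is twice the pairing of \<open>w\<close> with \<open>A u\<close>.\<close>

lemma quad_form_add_scaled:
  assumes "\<And>i j. a i j = a j i"
  shows "quad_form n a (\<lambda>i. u i + s * w i) =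
    quad_form n a u + 2 * s * (\<Sum>i<n. w i * (\<Sum>j<n. a i j * u j)) + s\<^sup>2 * quad_form n a w"
proof -
  have swap: "(\<Sum>i<n. \<Sum>j<n. u i * (a i j * w j)) = (\<Sum>i<n. \<Sum>j<n. w i * (a i j * u j))"
    by (subst sum.swap) (simp add: assms mult_ac)
  have "quad_form n a (\<lambda>i. u i + s * w i) = (\<Sum>i<n. \<Sum>j<n. u i * a i j * u j +
      s * (u i * (a i j * w j)) + s * (w i * (a i j * u j)) + s\<^sup>2 * (w i * a i j * w j))"
    unfolding quad_form_def by (intro sum.cong refl) (simp add: algebra_simps power2_eq_square)
  also have "\<dots> = quad_form n a u + s * (\<Sum>i<n. \<Sum>j<n. u i * (a i j * w j)) +
      s * (\<Sum>i<n. \<Sum>j<n. w i * (a i j * u j)) + s\<^sup>2 * quad_form n a w"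
    by (simp add: quad_form_def sum.distrib sum_distrib_left)
  finally show ?thesis
    unfolding swap by (simp add: sum_distrib_left mult.assoc)
qed

text \<open>Moving from \<open>u\<close> along its image \<open>w = A u\<close> changes the form to first order by \<open>|w|\<^sup>2\<close>,
  so a zero of a nonnegative form forces \<open>w = 0\<close>.\<close>

lemma nonneg_quad_form_zero_imp_kernel:
  assumes sym: "\<And>i j. a i j = a j i"
    and nonneg: "\<And>u. 0 \<le> quad_form n a u"
    and zero: "quad_form n a u = 0" and "i < n"
  shows "(\<Sum>j<n. a i j * u j) = 0"
proof -
  define w where "w i = (\<Sum>j<n. a i j * u j)" for i
  define b where "b = (\<Sum>i<n. w i * w i)"
  define c where "c = quad_form n a w"
  have "c \<ge> 0" using nonneg by (simp add: c_def)
  have ge: "0 \<le> 2 * s * b + s\<^sup>2 * c" for s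
    using nonneg[of "\<lambda>i. u i + s * w i"] zero
    unfolding quad_form_add_scaled[OF sym] by (simp add: b_def c_def flip: w_def)
  have "b = 0"
  proof (rule ccontr)
    assume "b \<noteq> 0"
    \<comment> \<open>The step length \<open>s = - b / e\<close> is used with
      \<open>e = c + 1\<close>, which stays positive even when \<open>c = 0\<close>; it makes the
      expansion in \<open>ge\<close> negative.\<close>
    have "2 * (- b / e) * b + (- b / e)\<^sup>2 * (e - 1) = - (b\<^sup>2 * (e + 1)) / e\<^sup>2" if "e > 0" for e
      using that by (simp add: divide_simps) (simp add: algebra_simps power2_eq_square)
    from this[of "c + 1"] have "2 * (- b / (c + 1)) * b + (- b / (c + 1))\<^sup>2 * c =
        - (b\<^sup>2 * (c + 2)) / (c + 1)\<^sup>2"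
      using \<open>c \<ge> 0\<close> by simp
    moreover have "b\<^sup>2 * (c + 2) / (c + 1)\<^sup>2 > 0"
      using \<open>c \<ge> 0\<close> \<open>b \<noteq> 0\<close> by (intro divide_pos_pos mult_pos_pos) auto
    ultimately show False
      using ge[of "- b / (c + 1)"] by simp
  qed
  then have "w i * w i = 0"
    using \<open>i < n\<close> unfolding b_def by (subst (asm) sum_nonneg_eq_0_iff) auto
  then show ?thesis by (simp add: w_def)
qed

text \<open>Tychonoff's theorem for a plain function type. It supplies compactness both of the unit
  sphere and of the feasible set of \<open>rho\<close>.\<close>

lemma compact_coordinate_box:
  fixes K :: "'a \<Rightarrow> 'b::topological_space set"
  assumes "\<And>i. compact (K i)"
  shows "compact {u. \<forall>i. u i \<in> K i}"
proof -
  have "compactin (product_topology (\<lambda>i. euclidean) UNIV) (PiE UNIV K)"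
    using assms by (simp add: compactin_PiE)
  moreover have "PiE UNIV K = {u. \<forall>i. u i \<in> K i}"
    by auto
  ultimately show ?thesis
    by (simp add: euclidean_product_topology)
qed

lemma continuous_on_quad_form: "continuous_on S (quad_form n a)"
  unfolding quad_form_def[abs_def]
  by (intro continuous_intros) (auto intro: continuous_on_subset[OF continuous_on_product_coordinates])

lemma quad_form_cong:
  assumes "\<And>i. i < n \<Longrightarrow> u i = v i"
  shows "quad_form n a u = quad_form n a v"
  unfolding quad_form_def using assms by (intro sum.cong) auto

text \<open>The quotient of the two forms is continuous on the compact unit sphere, since
  \<open>c\<close> is positive there, and so attains its minimum. Both forms being homogeneous of
  degree 2, the bound extends to every \<open>v\<close>.\<close>

lemma generalized_rayleigh_minimum:
  assumes "n > 0"
    and pos: "\<And>u. \<exists>i<n. u i \<noteq> 0 \<Longrightarrow> 0 < quad_form n c u"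
  shows "\<exists>\<theta> u. (\<exists>i<n. u i \<noteq> 0) \<and> quad_form n a u = \<theta> * quad_form n c u \<and>
    (\<forall>v. \<theta> * quad_form n c v \<le> quad_form n a v)"
proof -
  \<comment> \<open>The unit sphere of the first \<open>n\<close> coordinates; the others are pinned
    to 0, as free coordinates would destroy compactness.\<close>
  define S where "S = {u :: nat \<Rightarrow> real. \<forall>i. u i \<in> (if i < n then {-1..1} else {0})} \<inter>
    {u. (\<Sum>i<n. (u i)\<^sup>2) = 1}"
  have "closed {u :: nat \<Rightarrow> real. (\<Sum>i<n. (u i)\<^sup>2) = 1}"
    by (intro closed_Collect_eq continuous_intros continuous_on_product_coordinates)
  then have "compact S"
    unfolding S_def by (intro compact_Int_closed compact_coordinate_box) auto
  have "(\<lambda>i. if i = 0 then 1 else 0) \<in> S"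
    using \<open>n > 0\<close> by (auto simp: S_def if_distrib[of "\<lambda>x. x\<^sup>2"] cong: if_cong)
  then have "S \<noteq> {}" by blast
  have S_nz: "\<exists>i<n. u i \<noteq> 0" if "u \<in> S" for u
  proof (rule ccontr)
    assume "\<not> (\<exists>i<n. u i \<noteq> 0)"
    then have "(\<Sum>i<n. (u i)\<^sup>2) = 0" by simp
    then show False using that by (simp add: S_def)
  qed
  define f where "f u = quad_form n a u / quad_form n c u" for u
  have "continuous_on S f"
    unfolding f_def[abs_def]
    by (intro continuous_on_divide continuous_on_quad_form) (use S_nz pos in fastforce)
  then obtain u where u: "u \<in> S" "\<And>v. v \<in> S \<Longrightarrow> f u \<le> f v"
    using continuous_attains_inf[OF \<open>compact S\<close> \<open>S \<noteq> {}\<close>] by blast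
  show ?thesis
  proof (intro exI[of _ "f u"] exI[of _ u] conjI allI)
    show "\<exists>i<n. u i \<noteq> 0" using S_nz u(1) .
    then show "quad_form n a u = f u * quad_form n c u"
      using pos[of u] by (simp add: f_def)
  next
    fix v
    show "f u * quad_form n c v \<le> quad_form n a v"
    proof (cases "\<exists>i<n. v i \<noteq> 0")
      case False
      then have "quad_form n b v = 0" for b
        by (simp add: quad_form_def)
      then show ?thesis by simp
    next
      case True
      define r where "r = sqrt (\<Sum>i<n. (v i)\<^sup>2)"
      from True obtain k where k: "k < n" "v k \<noteq> 0" by blast
      have "(\<Sum>i<n. (v i)\<^sup>2) > 0"
        using k by (intro sum_pos2[of _ k]) auto
      then have r: "r > 0" "r\<^sup>2 = (\<Sum>i<n. (v i)\<^sup>2)" by (auto simp: r_def)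
      \<comment> \<open>Normalizes \<open>v\<close> and also cuts it off at \<open>n\<close>,
        because membership in \<open>S\<close> constrains the coordinates beyond.\<close>
      define w where "w i = (if i < n then v i / r else 0)" for i
      have norm_w: "(\<Sum>i<n. (w i)\<^sup>2) = 1"
        using r(1) by (simp add: w_def power_divide flip: sum_divide_distrib r(2))
      have "\<bar>w i\<bar> \<le> 1" if "i < n" for i
      proof -
        have "(w i)\<^sup>2 \<le> (\<Sum>i<n. (w i)\<^sup>2)"
          using that by (intro member_le_sum) auto
        then show ?thesis using norm_w by (simp add: abs_square_le_1)
      qed
      then have "w i \<in> (if i < n then {-1..1} else {0})" for i
        using abs_le_D1 abs_le_D2 by (fastforce simp: w_def[of i] minus_le_iff simp del: abs_divide)
      then have "w \<in> S"
        using norm_w by (simp add: S_def)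
      have vw: "quad_form n b v = r\<^sup>2 * quad_form n b w" for b
      proof -
        have "quad_form n b v = quad_form n b (\<lambda>i. r * w i)"
          using r by (intro quad_form_cong) (simp add: w_def)
        also have "\<dots> = r\<^sup>2 * quad_form n b w"
          by (simp add: quad_form_def sum_distrib_left power2_eq_square mult_ac)
        finally show ?thesis .
      qed
      have "f u * quad_form n c w \<le> quad_form n a w"
        using u(2)[OF \<open>w \<in> S\<close>] pos[OF S_nz[OF \<open>w \<in> S\<close>]] by (simp add: f_def[of w] field_simps)
      then show ?thesis
        unfolding vw mult.left_commute[of "f u"] by (intro mult_left_mono) auto
    qed
  qed
qed

text \<open>With \<mu> the minimal quotient, the form of \<open>a - \<mu> c\<close> is nonnegative
  and vanishes at the minimizer, which is therefore an eigenvector for \<mu>. Conversely, every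
  eigenvalue is the quotient at its own eigenvector, hence at least \<mu>.\<close>

lemma lambda_min_kernel_mat:
  assumes "n > 0"
    and syma: "\<And>i j. a i j = a j i" and symc: "\<And>i j. c i j = c j i"
    and pos: "\<And>u. \<exists>i<n. u i \<noteq> 0 \<Longrightarrow> 0 < quad_form n c u"
  defines "\<theta> \<equiv> lambda_min (kernel_mat n a) (kernel_mat n c)"
  shows "is_least (gen_eigenvalues (kernel_mat n a) (kernel_mat n c)) \<theta>"
    and "is_greatest {\<tau>. loewner_le (\<tau> \<cdot>\<^sub>m kernel_mat n c) (kernel_mat n a)} \<theta>"
proof -
  obtain \<mu> u where u: "\<exists>i<n. u i \<noteq> 0" "quad_form n a u = \<mu> * quad_form n c u"
    and min: "\<And>v. \<mu> * quad_form n c v \<le> quad_form n a v"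
    using generalized_rayleigh_minimum[where n = n and a = a and c = c, OF \<open>n > 0\<close> pos] by auto
  let ?b = "\<lambda>i j. a i j - \<mu> * c i j"
  have ker: "(\<Sum>j<n. ?b i j * u j) = 0" if "i < n" for i
  proof (rule nonneg_quad_form_zero_imp_kernel[OF _ _ _ that])
    show "?b i j = ?b j i" for i j using syma symc by metis
    show "0 \<le> quad_form n ?b v" for v using min[of v] by (simp add: quad_form_diff quad_form_scale)
    show "quad_form n ?b u = 0" using u by (simp add: quad_form_diff quad_form_scale)
  qed
  have "(\<Sum>j<n. a i j * u j) = \<mu> * (\<Sum>j<n. c i j * u j)" if "i < n" for i
    using ker[OF that] by (simp add: algebra_simps sum_subtractf sum_distrib_left)
  then have mem: "\<mu> \<in> gen_eigenvalues (kernel_mat n a) (kernel_mat n c)"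
    using u(1) by (auto simp: gen_eigenvalues_kernel_mat_iff)
  have le: "\<mu> \<le> \<nu>" if \<nu>: "\<nu> \<in> gen_eigenvalues (kernel_mat n a) (kernel_mat n c)" for \<nu>
  proof -
    obtain v where v: "\<exists>i<n. v i \<noteq> 0" "\<And>i. i < n \<Longrightarrow> (\<Sum>j<n. a i j * v j) = \<nu> * (\<Sum>j<n. c i j * v j)"
      using \<nu> unfolding gen_eigenvalues_kernel_mat_iff by blast
    have "quad_form n a v = (\<Sum>i<n. v i * (\<Sum>j<n. a i j * v j))"
      by (simp add: quad_form_def sum_distrib_left mult.assoc)
    also have "\<dots> = (\<Sum>i<n. v i * (\<nu> * (\<Sum>j<n. c i j * v j)))"
      using v(2) by (intro sum.cong) auto
    also have "\<dots> = \<nu> * quad_form n c v"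
      by (simp add: quad_form_def sum_distrib_left mult_ac)
    finally have "\<mu> * quad_form n c v \<le> \<nu> * quad_form n c v"
      using min[of v] by simp
    then show ?thesis using pos[OF v(1)] by simp
  qed
  from mem le have least: "is_least (gen_eigenvalues (kernel_mat n a) (kernel_mat n c)) \<mu>"
    by (simp add: is_least_def)
  have "\<theta> = \<mu>"
    unfolding \<theta>_def lambda_min_def
    by (intro the_equality least) (use mem le in \<open>auto simp: is_least_def intro: antisym\<close>)
  with least show "is_least (gen_eigenvalues (kernel_mat n a) (kernel_mat n c)) \<theta>"
    by simp
  have "loewner_le (\<tau> \<cdot>\<^sub>m kernel_mat n c) (kernel_mat n a) \<longleftrightarrow>
      (\<forall>v. \<tau> * quad_form n c v \<le> quad_form n a v)" for \<tau>
    unfolding smult_kernel_mat quad_form_scale[symmetric]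
    by (intro loewner_le_kernel_mat_iff syma) (simp add: symc)
  \<comment> \<open>Equality holds at the minimizer \<open>u\<close>, so testing there excludes any
    larger factor.\<close>
  moreover have "\<tau> \<le> \<mu>" if "\<forall>v. \<tau> * quad_form n c v \<le> quad_form n a v" for \<tau>
    using that[rule_format, of u] u(2) pos[OF u(1)] by simp
  ultimately show "is_greatest {\<tau>. loewner_le (\<tau> \<cdot>\<^sub>m kernel_mat n c) (kernel_mat n a)} \<theta>"
    using min \<open>\<theta> = \<mu>\<close> by (auto simp: is_greatest_def)
qed

section \<open>Moments of the reference density and positivity of \<open>M_star\<close>\<close>

text \<open>The Hankel matrix of powers of \<open>z\<close> is the outer product of
  \<open>(1, z, z^2, ...)\<close> with itself. Integrating this identity gives the positivity of all
  moment matrices below.\<close>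

lemma quad_form_hankel_power:
  "quad_form n (\<lambda>i j. z ^ (i + j)) u = (\<Sum>i<n. u i * z ^ i)\<^sup>2"
  unfolding quad_form_def power2_eq_square sum_product
  by (simp add: power_add mult_ac)

text \<open>The integrand is \<open>n\<close> times the power of \<open>s\<close> with exponent
  \<open>n + k t - 1\<close>, so a multiple of the next power is an antiderivative.\<close>

lemma has_integral_star_moment:
  assumes "n > 0"
  shows "((\<lambda>s::real. real n * s ^ (n - 1) * (s ^ t) ^ k) has_integral
    real n / (real n + real k * real t)) {0..1}"
proof -
  let ?m = "n + k * t"
  have "((\<lambda>s::real. real n / real ?m * s ^ ?m) has_real_derivative
      real n / real ?m * (real ?m * s ^ (?m - 1))) (at s within {0..1})" for s
    by (auto intro!: derivative_eq_intros)
  moreover have "real n / real ?m * (real ?m * s ^ (?m - 1)) = real n * s ^ (n - 1) * (s ^ t) ^ k"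
    for s :: real
  proof -
    have "?m - 1 = n - 1 + t * k" using assms by (simp add: mult.commute)
    then have "s ^ (?m - 1) = s ^ (n - 1) * (s ^ t) ^ k"
      by (simp only: power_add power_mult)
    moreover have "x / real ?m * (real ?m * y) = x * y" for x y
      using assms by (simp del: of_nat_add)
    ultimately show ?thesis by (simp only: mult.assoc)
  qed
  ultimately have "((\<lambda>s::real. real n / real ?m * s ^ ?m) has_vector_derivative
      real n * s ^ (n - 1) * (s ^ t) ^ k) (at s within {0..1})" for s
    by (metis has_real_derivative_iff_has_vector_derivative)
  from fundamental_theorem_of_calculus[OF _ this]
  show ?thesis using assms by (simp add: power_0_left)
qed

lemma has_integral_quad_form:
  assumes "\<And>i j. ((\<lambda>s. f s i j) has_integral a i j) S"
  shows "((\<lambda>s. quad_form n (f s) u) has_integral quad_form n a u) S"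
  unfolding quad_form_def
  by (intro has_integral_sum has_integral_mult_left has_integral_mult_right assms) auto

definition star_moment :: "nat \<Rightarrow> nat \<Rightarrow> nat \<Rightarrow> real" where
  "star_moment n t k = real n / (real n + real k * real t)"

lemma has_integral_star_quad_form:
  assumes "n > 0"
  shows "((\<lambda>s::real. real n * s ^ (n - 1) * (\<Sum>i<m. u i * (s ^ t) ^ i)\<^sup>2) has_integral
    quad_form m (\<lambda>i j. star_moment n t (i + j)) u) {0..1}"
proof -
  have "((\<lambda>s::real. quad_form m (\<lambda>i j. real n * s ^ (n - 1) * (s ^ t) ^ (i + j)) u) has_integral
      quad_form m (\<lambda>i j. star_moment n t (i + j)) u) {0..1}"
    unfolding star_moment_def
    using has_integral_star_moment[OF assms] by (intro has_integral_quad_form) blast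
  then show ?thesis
    by (simp only: quad_form_scale quad_form_hankel_power)
qed

text \<open>A zero integral of a continuous nonnegative integrand would make the integrand vanish on
  the interval, giving a nonzero polynomial infinitely many roots.\<close>

lemma star_quad_form_pos:
  assumes "n > 0" "t > 0" "\<exists>i<m. u i \<noteq> 0"
  shows "0 < quad_form m (\<lambda>i j. star_moment n t (i + j)) u"
proof -
  let ?I = "quad_form m (\<lambda>i j. star_moment n t (i + j)) u"
  let ?f = "\<lambda>s::real. real n * s ^ (n - 1) * (\<Sum>i<m. u i * (s ^ t) ^ i)\<^sup>2"
  have int: "(?f has_integral ?I) {0..1}"
    by (rule has_integral_star_quad_form[OF \<open>n > 0\<close>])
  have "?I \<ge> 0"
    using int by (rule has_integral_nonneg) simp
  moreover have "?I \<noteq> 0"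
  proof
    assume "?I = 0"
    have fz: "?f s = 0" if "s \<in> {0..1}" for s
    proof (rule has_integral_0_cbox_imp_0[where f = ?f and a = 0 and b = 1])
      show "continuous_on (cbox 0 1) ?f" by (intro continuous_intros)
      show "(?f has_integral 0) (cbox 0 1)" using int \<open>?I = 0\<close> by simp
    qed (use that in auto)
    have root: "(\<Sum>i<m. u i * z ^ i) = 0" if z: "z \<in> {0<..<1}" for z
    proof -
      \<comment> \<open>Each \<open>z\<close> is the \<open>t\<close>-th power of a strictly
        positive point, where the weight \<open>n * s ^ (n - 1)\<close> is nonzero; the squared
        polynomial must then vanish.\<close>
      have "root t z \<in> {0..1}" "root t z > 0" "root t z ^ t = z"
        using z \<open>t > 0\<close> by auto
      with fz[of "root t z"] \<open>n > 0\<close> show ?thesis by simp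
    qed
    obtain l where l: "m = Suc l" using assms(3) by (cases m) auto
    have "{0<..<1} \<subseteq> {z. (\<Sum>i\<le>l. u i * z ^ i) = 0}"
      using root by (auto simp: l lessThan_Suc_atMost)
    then have "infinite {z. (\<Sum>i\<le>l. u i * z ^ i) = 0}"
      by (rule infinite_super) (simp add: infinite_Ioo)
    then show False
      using assms(3) by (auto simp: polyfun_finite_roots l less_Suc_eq_le)
  qed
  ultimately show ?thesis by simp
qed

text \<open>With \<open>z = s ^ t\<close>, the integrand is a square times the density and
  \<open>z (1 - z)\<close>, all nonnegative on the unit interval.\<close>

lemma star_localizing_quad_form_nonneg:
  assumes "n > 0"
  shows "0 \<le> quad_form m (\<lambda>i j. star_moment n t (i + j + 1) - star_moment n t (i + j + 2)) u"
proof -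
  have "((\<lambda>s::real. quad_form m (\<lambda>i j. real n * s ^ (n - 1) * (s ^ t) ^ (i + j + 1) -
        real n * s ^ (n - 1) * (s ^ t) ^ (i + j + 2)) u) has_integral
      quad_form m (\<lambda>i j. star_moment n t (i + j + 1) - star_moment n t (i + j + 2)) u) {0..1}"
    unfolding star_moment_def
    using has_integral_star_moment[OF assms] by (intro has_integral_quad_form has_integral_diff) blast+
  moreover have "0 \<le> quad_form m (\<lambda>i j. real n * s ^ (n - 1) * (s ^ t) ^ (i + j + 1) -
        real n * s ^ (n - 1) * (s ^ t) ^ (i + j + 2)) u" if "s \<in> {0..1}" for s
  proof -
    have "(\<lambda>i j. real n * s ^ (n - 1) * (s ^ t) ^ (i + j + 1) -
        real n * s ^ (n - 1) * (s ^ t) ^ (i + j + 2)) =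
      (\<lambda>i j. (real n * s ^ (n - 1) * s ^ t * (1 - s ^ t)) * (s ^ t) ^ (i + j))"
      by (intro ext) (simp add: algebra_simps power_add power2_eq_square)
    then show ?thesis
      using that by (simp add: quad_form_scale quad_form_hankel_power power_le_one)
  qed
  ultimately show ?thesis by (rule has_integral_nonneg)
qed

section \<open>Moments of the pushforward measure\<close>

lemma continuous_on_poly_eval: "continuous_on S (poly_eval p)"
  unfolding poly_eval_def[abs_def] by (intro continuous_intros)

lemma box_B_eq_cbox: "box_B = cbox (- 1) (1 :: real ^ 'n::finite)"
  by (auto simp: box_B_def mem_box_cart)

lemma finite_measure_lambda_B: "finite_measure (lambda_B :: (real ^ 'n::finite) measure)"
proof
  have "emeasure lborel (box_B :: (real ^ 'n) set) < \<infinity>"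
    unfolding box_B_eq_cbox by (rule emeasure_lborel_cbox_finite)
  then show "emeasure (lambda_B :: (real ^ 'n) measure) (space lambda_B) \<noteq> \<infinity>"
    unfolding lambda_B_def by (simp add: box_B_eq_cbox ennreal_divide_eq_top_iff)
qed

text \<open>On the compact box \<open>g\<close> is bounded, so its powers are integrable for the
  finite measure \<open>lambda_B\<close>; a change of variables transfers this to the
  pushforward.\<close>

lemma integrable_power_pushforward:
  fixes g :: "real ^ 'n::finite \<Rightarrow> real"
  assumes "continuous_on UNIV g"
  shows "integrable (pushforward g) (\<lambda>z. z ^ k)"
proof -
  have [measurable]: "g \<in> borel_measurable borel"
    using assms by (rule borel_measurable_continuous_onI)
  have "compact (g ` box_B)"
    unfolding box_B_eq_cbox
    by (intro compact_continuous_image compact_cbox continuous_on_subset[OF assms]) auto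
  then obtain K where K: "\<And>x. x \<in> box_B \<Longrightarrow> norm (g x) \<le> K"
    using compact_imp_bounded bounded_iff by (metis imageI)
  have "AE x in lambda_B. norm (g x ^ k) \<le> K ^ k"
    unfolding lambda_B_def
    by (rule AE_uniform_measureI)
      (auto simp: box_B_eq_cbox[symmetric] power_abs intro!: power_mono K[simplified], simp add: box_B_eq_cbox)
  then have "integrable lambda_B (\<lambda>x. g x ^ k)"
    by (intro finite_measure.integrable_const_bound[OF finite_measure_lambda_B])
      (auto simp: lambda_B_def)
  moreover have "g \<in> borel_measurable lambda_B"
    by (simp add: lambda_B_def)
  ultimately show ?thesis
    unfolding pushforward_def by (subst integrable_distr_eq) auto
qed

lemma push_moment_quad_form_nonneg:
  assumes "continuous_on UNIV g"
  shows "0 \<le> quad_form n (\<lambda>i j. push_moment g (i + j)) u"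
proof -
  have "quad_form n (\<lambda>i j. push_moment g (i + j)) u =
      (LINT z|pushforward g. quad_form n (\<lambda>i j. z ^ (i + j)) u)"
    using integrable_power_pushforward[OF assms]
    by (simp add: quad_form_def push_moment_def)
  also have "\<dots> \<ge> 0"
    by (simp add: quad_form_hankel_power)
  finally show ?thesis .
qed

section \<open>The feasible set of \<open>rho\<close> and attainment of its maximum\<close>

definition rho_feasible :: "nat \<Rightarrow> (nat \<Rightarrow> real) \<Rightarrow> (nat \<Rightarrow> real) \<Rightarrow> bool" where
  "rho_feasible d m \<phi> \<longleftrightarrow>
    (\<forall>u. 0 \<le> quad_form (d + 1) (\<lambda>i j. \<phi> (i + j)) u) \<and>
    (\<forall>u. quad_form (d + 1) (\<lambda>i j. \<phi> (i + j)) u \<le> quad_form (d + 1) (\<lambda>i j. m (i + j)) u) \<and>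
    (\<forall>u. 0 \<le> quad_form d (\<lambda>i j. \<phi> (i + j + 1) - \<phi> (i + j + 2)) u)"

lemma rho_values_eq: "rho_values g d = {\<phi> 0 | \<phi>. rho_feasible d (push_moment g) \<phi>}"
  unfolding rho_values_def rho_feasible_def moment_matrix_def localizing_matrix_def zero_mat_eq_kernel_mat
  by (simp add: loewner_le_kernel_mat_iff add.commute)

text \<open>Allows a feasible sequence to be truncated after index \<open>2 * d\<close>, which the
  compactness argument requires.\<close>

lemma rho_feasible_cong:
  assumes "\<And>k. k \<le> 2 * d \<Longrightarrow> \<phi> k = \<psi> k"
  shows "rho_feasible d m \<phi> \<longleftrightarrow> rho_feasible d m \<psi>"
proof -
  have "quad_form (d + 1) (\<lambda>i j. \<phi> (i + j)) u = quad_form (d + 1) (\<lambda>i j. \<psi> (i + j)) u" for u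
    unfolding quad_form_def using assms by (intro sum.cong refl) simp
  moreover have "quad_form d (\<lambda>i j. \<phi> (i + j + 1) - \<phi> (i + j + 2)) u =
      quad_form d (\<lambda>i j. \<psi> (i + j + 1) - \<psi> (i + j + 2)) u" for u
    unfolding quad_form_def using assms by (intro sum.cong refl) simp
  ultimately show ?thesis by (simp add: rho_feasible_def)
qed

lemma closed_rho_feasible: "closed {\<phi>. rho_feasible d m \<phi>}"
  unfolding rho_feasible_def quad_form_def
  by (intro closed_Collect_conj closed_Collect_all closed_Collect_le continuous_intros
      continuous_on_product_coordinates)

text \<open>Test vectors supported on two indices isolate a two-by-two principal submatrix.\<close>

lemma quad_form_two_point:
  assumes "p < n" "q < n" "p \<noteq> q"
  shows "quad_form n a (\<lambda>i. if i = p then x else if i = q then y else 0) =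
    x * a p p * x + x * a p q * y + y * a q p * x + y * a q q * y"
proof -
  let ?u = "\<lambda>i. if i = p then x else if i = q then y else 0"
  have sum2: "(\<Sum>i<n. f i) = f p + f q" if "\<And>i. i \<noteq> p \<Longrightarrow> i \<noteq> q \<Longrightarrow> f i = 0" for f :: "nat \<Rightarrow> real"
  proof -
    have "(\<Sum>i<n. f i) = (\<Sum>i\<in>{p, q}. f i)"
      using assms that by (intro sum.mono_neutral_right) auto
    then show ?thesis using assms by simp
  qed
  have "(\<Sum>j<n. ?u i * a i j * ?u j) = ?u i * a i p * x + ?u i * a i q * y" for i
    using assms by (subst sum2) auto
  then show ?thesis
    unfolding quad_form_def using assms by (simp, subst sum2) auto
qed

text \<open>Unit vectors bound the even entries between 0 and those of \<open>m\<close>. An odd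
  entry is at most the mean of its two even neighbours in absolute value.\<close>

lemma rho_feasible_bounded:
  assumes "rho_feasible d m \<phi>" "d \<ge> 1" "k \<le> 2 * d"
  shows "\<bar>\<phi> k\<bar> \<le> (\<Sum>i\<le>d. \<bar>m (2 * i)\<bar>)"
proof -
  let ?S = "\<Sum>i\<le>d. \<bar>m (2 * i)\<bar>"
  have nonneg: "0 \<le> quad_form (d + 1) (\<lambda>i j. \<phi> (i + j)) u"
    and le: "quad_form (d + 1) (\<lambda>i j. \<phi> (i + j)) u \<le> quad_form (d + 1) (\<lambda>i j. m (i + j)) u" for u
    using assms(1) by (auto simp: rho_feasible_def)
  have even_case: "0 \<le> \<phi> (2 * i) \<and> \<phi> (2 * i) \<le> ?S" if "i \<le> d" for i
  proof -
    \<comment> \<open>A dummy second index carrying weight 0, available because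
      \<open>d \<ge> 1\<close>, lets the two-point formula serve for a unit vector.\<close>
    obtain q where q: "q < d + 1" "q \<noteq> i"
      using \<open>d \<ge> 1\<close> by (cases "i = 0") (auto intro: that[of 0] that[of 1])
    let ?u = "\<lambda>l. if l = i then 1 else if l = q then 0 else 0 :: real"
    have "quad_form (d + 1) (\<lambda>i j. b (i + j)) ?u = b (2 * i)" for b
      using quad_form_two_point[of i "d + 1" q "\<lambda>i j. b (i + j)" 1 0] that q by (simp add: mult_2)
    with nonneg[of ?u] le[of ?u] have "0 \<le> \<phi> (2 * i)" "\<phi> (2 * i) \<le> m (2 * i)" by auto
    moreover have "\<bar>m (2 * i)\<bar> \<le> ?S"
      using that by (intro member_le_sum) auto
    ultimately show ?thesis by linarith
  qed
  show ?thesis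
  proof (cases "even k")
    case True
    then show ?thesis using even_case[of "k div 2"] assms(3) by auto
  next
    case False
    then obtain i where k: "k = 2 * i + 1" by (elim oddE)
    then have i: "i < d" using assms(3) by simp
    have two: "i + i = 2 * i" "Suc i + Suc i = 2 * Suc i" "i + Suc i = k" "Suc i + i = k"
      using k by auto
    have "0 \<le> \<phi> (2 * i) + 2 * (x * \<phi> k) + x * \<phi> (2 * Suc i) * x" for x
      using nonneg[of "\<lambda>l. if l = i then 1 else if l = Suc i then x else 0"]
        quad_form_two_point[of i "d + 1" "Suc i" "\<lambda>i j. \<phi> (i + j)" 1 x] i
      unfolding two by (simp add: algebra_simps)
    \<comment> \<open>The two signs bound \<phi> \<open>k\<close> from below and from above.\<close>
    from this[of 1] this[of "-1"] even_case[of i] even_case[of "Suc i"] i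
    show ?thesis by auto
  qed
qed

text \<open>Truncated feasible sequences form a nonempty compact set on which evaluation at 0 is
  continuous. Truncation preserves the objective, so the maximum there is the maximum over all
  feasible sequences.\<close>

lemma is_greatest_rho:
  assumes "continuous_on UNIV g" "d \<ge> 1"
  shows "is_greatest (rho_values g d) (rho g d)"
proof -
  let ?m = "push_moment g"
  define R where "R = (\<Sum>i\<le>d. \<bar>?m (2 * i)\<bar>)"
  define F where "F = {\<phi>. \<forall>k. \<phi> k \<in> (if k \<le> 2 * d then {-R..R} else {0})} \<inter> {\<phi>. rho_feasible d ?m \<phi>}"
  have "compact F"
    unfolding F_def by (intro compact_Int_closed compact_coordinate_box closed_rho_feasible) auto
  moreover have "(\<lambda>k. 0) \<in> F"
    using push_moment_quad_form_nonneg[OF assms(1)]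
    by (auto simp: F_def R_def rho_feasible_def sum_nonneg)
  moreover have "continuous_on F (\<lambda>\<phi>. \<phi> 0)"
    by (rule continuous_on_subset[OF continuous_on_product_coordinates]) simp
  ultimately obtain \<phi> where \<phi>: "\<phi> \<in> F" "\<And>\<psi>. \<psi> \<in> F \<Longrightarrow> \<psi> 0 \<le> \<phi> 0"
    using continuous_attains_sup[of F "\<lambda>\<phi>. \<phi> 0"] by blast
  have "\<psi> 0 \<le> \<phi> 0" if \<psi>: "rho_feasible d ?m \<psi>" for \<psi>
  proof -
    define \<xi> where "\<xi> k = (if k \<le> 2 * d then \<psi> k else 0)" for k
    have "rho_feasible d ?m \<xi>"
      using \<psi> by (subst rho_feasible_cong[of d \<xi> \<psi>]) (auto simp: \<xi>_def)
    moreover have "\<xi> k \<in> (if k \<le> 2 * d then {-R..R} else {0})" for k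
      using rho_feasible_bounded[OF \<psi> assms(2), of k] by (auto simp: \<xi>_def R_def abs_le_iff)
    ultimately have "\<xi> \<in> F" by (simp add: F_def)
    then show ?thesis using \<phi>(2) by (fastforce simp: \<xi>_def)
  qed
  then have "is_greatest (rho_values g d) (\<phi> 0)"
    using \<phi>(1) by (auto simp: is_greatest_def rho_values_eq F_def)
  moreover from this have "rho g d = \<phi> 0"
    unfolding rho_def by (intro the_equality) (auto simp: is_greatest_def intro: antisym)
  ultimately show ?thesis by simp
qed

section \<open>Comparison of \<open>rho\<close> and \<open>tau\<close>\<close>

lemma moment_matrix_eq: "moment_matrix d \<phi> = kernel_mat (d + 1) (\<lambda>i j. \<phi> (i + j))"
  by (simp add: moment_matrix_def)

lemma M_star_eq: "M_star n t d = kernel_mat (d + 1) (\<lambda>i j. star_moment n t (i + j))"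
  by (simp add: M_star_def star_moment_def)

theorem proposition3p3:
  fixes p :: "('n::finite \<Rightarrow>\<^sub>0 nat) \<Rightarrow>\<^sub>0 real"
    and g :: "real ^ 'n \<Rightarrow> real"
    and t :: nat
  defines "g \<equiv> poly_eval p"
  assumes "t \<ge> 2" and "even t"
    and "homogeneous_of_degree p t"
    and "\<forall>x. 0 \<le> g x"
    and "{x. g x \<le> 1} \<subseteq> box_B"
    and "frontier {x. g x \<le> 1} \<subseteq> {x. g x = 1}"
  shows "\<forall>d::nat. d \<ge> 1 \<longrightarrow>
           is_greatest (rho_values g d) (rho g d) \<and>
           is_least (gen_eigenvalues (moment_matrix d (push_moment g)) (M_star CARD('n) t d))
                    (tau g t d) \<and>
           is_greatest {\<tau>. loewner_le (\<tau> \<cdot>\<^sub>m M_star CARD('n) t d) (moment_matrix d (push_moment g))}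
                       (tau g t d) \<and>
           rho g d \<ge> tau g t d"
proof (intro allI impI)
  fix d :: nat
  assume d: "d \<ge> 1"
  have cont: "continuous_on UNIV g"
    unfolding g_def by (rule continuous_on_poly_eval)
  let ?n = "CARD('n)" and ?\<tau> = "tau g t d"
  let ?s = "star_moment ?n t"
  have "t > 0" using \<open>t \<ge> 2\<close> by simp
  have pos: "0 < quad_form (d + 1) (\<lambda>i j. ?s (i + j)) u" if "\<exists>i<d + 1. u i \<noteq> 0" for u
    using star_quad_form_pos[OF _ \<open>t > 0\<close> that] by simp
  have least: "is_least (gen_eigenvalues (moment_matrix d (push_moment g)) (M_star ?n t d)) ?\<tau>"
    unfolding tau_def moment_matrix_eq M_star_eq
    by (rule lambda_min_kernel_mat(1)[OF _ _ _ pos]) (simp_all add: add.commute)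
  have greatest: "is_greatest {\<tau>. loewner_le (\<tau> \<cdot>\<^sub>m M_star ?n t d) (moment_matrix d (push_moment g))} ?\<tau>"
    unfolding tau_def moment_matrix_eq M_star_eq
    by (rule lambda_min_kernel_mat(2)[OF _ _ _ pos]) (simp_all add: add.commute)
  have psd_le: "loewner_le (\<tau> \<cdot>\<^sub>m M_star ?n t d) (moment_matrix d (push_moment g)) \<longleftrightarrow>
      (\<forall>u. \<tau> * quad_form (d + 1) (\<lambda>i j. ?s (i + j)) u \<le>
        quad_form (d + 1) (\<lambda>i j. push_moment g (i + j)) u)" for \<tau>
    unfolding moment_matrix_eq M_star_eq smult_kernel_mat
    by (subst loewner_le_kernel_mat_iff) (auto simp: add.commute quad_form_scale)
  \<comment> \<open>The factor 0 is admissible because the moment matrix of the pushforward is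
    positive semidefinite, and \<open>tau\<close> is the greatest admissible factor.\<close>
  have "?\<tau> \<ge> 0"
    using greatest psd_le[of 0] push_moment_quad_form_nonneg[OF cont] by (auto simp: is_greatest_def)
  have nonneg: "0 \<le> quad_form (d + 1) (\<lambda>i j. ?s (i + j)) u" for u
    using has_integral_star_quad_form[of ?n] by (rule has_integral_nonneg) auto
  have "rho_feasible d (push_moment g) (\<lambda>k. ?\<tau> * ?s k)"
    using greatest nonneg \<open>?\<tau> \<ge> 0\<close> star_localizing_quad_form_nonneg[of ?n d t]
    unfolding rho_feasible_def right_diff_distrib[symmetric] quad_form_scale
    by (simp add: is_greatest_def psd_le)
  then have "?\<tau> * ?s 0 \<in> rho_values g d"
    unfolding rho_values_eq by (intro CollectI exI[of _ "\<lambda>k. ?\<tau> * ?s k"]) simp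
  \<comment> \<open>The zeroth reference moment is \<open>n / n = 1\<close>, so the scaled sequence
    has objective value exactly \<open>tau\<close>.\<close>
  then have "?\<tau> \<le> rho g d"
    using is_greatest_rho[OF cont d] by (auto simp: is_greatest_def star_moment_def)
  with least greatest is_greatest_rho[OF cont d]
  show "is_greatest (rho_values g d) (rho g d) \<and>
      is_least (gen_eigenvalues (moment_matrix d (push_moment g)) (M_star ?n t d)) ?\<tau> \<and>
      is_greatest {\<tau>. loewner_le (\<tau> \<cdot>\<^sub>m M_star ?n t d) (moment_matrix d (push_moment g))} ?\<tau> \<and>
      rho g d \<ge> ?\<tau>"
    by blast
qed

end
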